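(* There exists a $\mathsf{PE}$-adapted $\mathsf{L}^\star_{\mathsf{CS}}$-subset model (for some logic $\mathsf{L}^\star$ and constant specification $\mathsf{CS}$ as in the context).
   Context: Terms $\mathsf{Tm}^{\mathsf{P}}$: $t::=0\mid 1\mid c_i\mid x_i\mid\mathsf{c}^\star\mid(t+t)\mid(t\cup t)\mid\ !t$ ($0,1,c_i$ constants, $x_i$ variables, $\mathsf{c}^\star$ a special constant). Formulas $\mathsf{L_{prob}}$: $F::=p_i\mid\bot\mid F\to F\mid t:F$ with $t\in\mathsf{Tm}^{\mathsf{P}}$. The $\mathsf{c}^\star$-terms: $\mathsf{c}^\star$ is one, and if $c$ is one and $s,t$ are any terms then $s+c$ and $c+t$ are. A logic $\mathsf{L}^\star$ consists of the axioms (cl) classical propositional axioms, (j+) $s:A\lor t:A\to(s+t):A$, (jc$^\star$) $c:A\land c:(A\to B)\to c:B$ for $\mathsf{c}^\star$-terms $c$, and some subset of $\{$(j4) $t:A\to\ !t:(t:A)$, (jd) $t:\bot\to\bot$, (jt) $t:A\to A\}$; a constant specification $\mathsf{CS}$ is a set of pairs $(c,A)$, $c$ a constant, $A$ an axiom of $\mathsf{L}^\star$. An $\mathsf{L}^\star_{\mathsf{CS}}$-subset model (over $\mathsf{Tm}^{\mathsf{P}}$, $\mathsf{L_{prob}}$) is $\mathcal{M}=(W,W_0,V,E)$ with $W$ a set, $\emptyset\ne W_0\subseteq W$, $V:W\times\mathsf{L_{prob}}\to\{0,1\}$, $E:W\times\mathsf{Tm}^{\mathsf{P}}\to\mathcal{P}(W)$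 such that, with $[A]=\{\upsilon:V(\upsilon,A)=1\}$ and $W_{MP}=\{\upsilon\in W:$ for all $A,B$, $V(\upsilon,A)=V(\upsilon,A\to B)=1$ implies $V(\upsilon,B)=1\}$, for all $\omega\in W_0$, $s,t$, $F,G$: $V(\omega,\bot)=0$; $V(\omega,F\to G)=1$ iff $V(\omega,F)=0$ or $V(\omega,G)=1$; $V(\omega,t:F)=1$ iff $E(\omega,t)\subseteq[F]$; $E(\omega,s+t)\subseteq E(\omega,s)\cap E(\omega,t)$; $E(\omega,\mathsf{c}^\star)\subseteq W_{MP}$; if (jd)$\in\mathsf{L}^\star$ some $\upsilon\in W_0$ is in $E(\omega,t)$; if (jt)$\in\mathsf{L}^\star$ then $\omega\in E(\omega,t)$; if (j4)$\in\mathsf{L}^\star$ then $E(\omega,!t)\subseteq\{\upsilon:\forall F\,(V(\omega,t:F)=1\Rightarrow V(\upsilon,t:F)=1)\}$; for $(c,A)\in\mathsf{CS}$, $n\ge1$: $E(\omega,c)\subseteq[A]$ and $E(\omega,!^nc)\subseteq[!^{n-1}c:\cdots:\,!c:c:A]$ ($!^kc$ is $c$ preceded by $k$ copies of $!$). It is $\mathsf{PE}$-adapted if moreover for all $\omega\in W_0$ and $s,t$: $E(\omega,1)=W_0$, $E(\omega,0)=\emptyset$, and $E(\omega,s\cup t)=E(\omega,s)\cup E(\omega,t)$. *)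

theory Defs
  imports Main
begin

datatype tm =
    Zero
  | One
  | Const nat
  | Var nat
  | CStar
  | Sum tm tm
  | Cup tm tm
  | Bang tm

datatype fm =
    Prop nat
  | Falsum  (\<open>\<bottom>\<^sub>F\<close>)
  | Imp fm fm  (infixr \<open>\<rightarrow>\<^sub>F\<close> 25)
  | Just tm fm  (infixr \<open>:\<^sub>F\<close> 60)

abbreviation Neg :: "fm \<Rightarrow> fm"  (\<open>\<not>\<^sub>F _\<close> [40] 40)
  where "\<not>\<^sub>F A \<equiv> (A \<rightarrow>\<^sub>F \<bottom>\<^sub>F)"

abbreviation Or :: "fm \<Rightarrow> fm \<Rightarrow> fm"  (infixr \<open>\<or>\<^sub>F\<close> 30)
  where "A \<or>\<^sub>F B \<equiv> ((\<not>\<^sub>F A) \<rightarrow>\<^sub>F B)"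

abbreviation And :: "fm \<Rightarrow> fm \<Rightarrow> fm"  (infixr \<open>\<and>\<^sub>F\<close> 35)
  where "A \<and>\<^sub>F B \<equiv> (\<not>\<^sub>F (A \<rightarrow>\<^sub>F \<not>\<^sub>F B))"

inductive cstar_term :: "tm \<Rightarrow> bool"
  where
    cstar: "cstar_term CStar"
  | sum_left: "cstar_term c \<Longrightarrow> cstar_term (Sum s c)"
  | sum_right: "cstar_term c \<Longrightarrow> cstar_term (Sum c t)"

definition is_constant :: "tm \<Rightarrow> bool"
  where "is_constant c \<longleftrightarrow> c = Zero \<or> c = One \<or> c = CStar \<or> (\<exists>i. c = Const i)"

text \<open>A logic is determined by which of the three optional axiom schemes it contains.\<close>

datatype scheme = j4 | jd | jt

type_synonym logic = "scheme set"

text \<open>The three \<open>cl\<close> schemes are, together with modus ponens, a complete axiomatisation of classical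
  propositional logic over implication and falsum.\<close>

inductive_set axioms :: "logic \<Rightarrow> fm set" for L :: logic
  where
    cl_K: "(A \<rightarrow>\<^sub>F B \<rightarrow>\<^sub>F A) \<in> axioms L"
  | cl_S: "((A \<rightarrow>\<^sub>F B \<rightarrow>\<^sub>F C) \<rightarrow>\<^sub>F (A \<rightarrow>\<^sub>F B) \<rightarrow>\<^sub>F A \<rightarrow>\<^sub>F C) \<in> axioms L"
  | cl_DN: "(\<not>\<^sub>F \<not>\<^sub>F A \<rightarrow>\<^sub>F A) \<in> axioms L"
  | ax_jplus: "(s :\<^sub>F A \<or>\<^sub>F t :\<^sub>F A \<rightarrow>\<^sub>F Sum s t :\<^sub>F A) \<in> axioms L"
  | ax_jcstar: "cstar_term c \<Longrightarrow> (c :\<^sub>F A \<and>\<^sub>F c :\<^sub>F (A \<rightarrow>\<^sub>F B) \<rightarrow>\<^sub>F c :\<^sub>F B) \<in> axioms L"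
  | ax_j4: "j4 \<in> L \<Longrightarrow> (t :\<^sub>F A \<rightarrow>\<^sub>F Bang t :\<^sub>F t :\<^sub>F A) \<in> axioms L"
  | ax_jd: "jd \<in> L \<Longrightarrow> (t :\<^sub>F \<bottom>\<^sub>F \<rightarrow>\<^sub>F \<bottom>\<^sub>F) \<in> axioms L"
  | ax_jt: "jt \<in> L \<Longrightarrow> (t :\<^sub>F A \<rightarrow>\<^sub>F A) \<in> axioms L"

definition constant_specification :: "logic \<Rightarrow> (tm \<times> fm) set \<Rightarrow> bool"
  where "constant_specification L CS \<longleftrightarrow> (\<forall>(c, A) \<in> CS. is_constant c \<and> A \<in> axioms L)"

text \<open>\<open>bang_fm n c A\<close> is the formula \<open>!\<^sup>n\<^sup>-\<^sup>1 c : \<dots> : ! c : c : A\<close>, and just \<open>A\<close> for \<open>n = 0\<close>.\<close>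

primrec bang_fm :: "nat \<Rightarrow> tm \<Rightarrow> fm \<Rightarrow> fm"
  where
    "bang_fm 0 c A = A"
  | "bang_fm (Suc n) c A = (Bang ^^ n) c :\<^sub>F bang_fm n c A"

text \<open>\<open>val M w A\<close> stands for $V(w, A) = 1$.\<close>

record 'w model =
  worlds :: "'w set"
  normal :: "'w set"
  val :: "'w \<Rightarrow> fm \<Rightarrow> bool"
  evid :: "'w \<Rightarrow> tm \<Rightarrow> 'w set"

definition truth_set :: "'w model \<Rightarrow> fm \<Rightarrow> 'w set"
  where "truth_set M A = {v \<in> worlds M. val M v A}"

definition W_MP :: "'w model \<Rightarrow> 'w set"
  where "W_MP M =
    {v \<in> worlds M. \<forall>A B. val M v A \<and> val M v (A \<rightarrow>\<^sub>F B) \<longrightarrow> val M v B}"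

definition subset_model :: "logic \<Rightarrow> (tm \<times> fm) set \<Rightarrow> 'w model \<Rightarrow> bool"
  where "subset_model L CS M \<longleftrightarrow>
    normal M \<noteq> {} \<and> normal M \<subseteq> worlds M \<and>
    (\<forall>w \<in> worlds M. \<forall>t. evid M w t \<subseteq> worlds M) \<and>
    (\<forall>w \<in> normal M.
      \<not> val M w \<bottom>\<^sub>F \<and>
      (\<forall>F G. val M w (F \<rightarrow>\<^sub>F G) \<longleftrightarrow> \<not> val M w F \<or> val M w G) \<and>
      (\<forall>t F. val M w (t :\<^sub>F F) \<longleftrightarrow> evid M w t \<subseteq> truth_set M F) \<and>
      (\<forall>s t. evid M w (Sum s t) \<subseteq> evid M w s \<inter> evid M w t) \<and>
      evid M w CStar \<subseteq> W_MP M \<and>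
      (jd \<in> L \<longrightarrow> (\<forall>t. \<exists>v \<in> normal M. v \<in> evid M w t)) \<and>
      (jt \<in> L \<longrightarrow> (\<forall>t. w \<in> evid M w t)) \<and>
      (j4 \<in> L \<longrightarrow> (\<forall>t. evid M w (Bang t) \<subseteq>
        {v \<in> worlds M. \<forall>F. val M w (t :\<^sub>F F) \<longrightarrow> val M v (t :\<^sub>F F)})) \<and>
      (\<forall>(c, A) \<in> CS.
        evid M w c \<subseteq> truth_set M A \<and>
        (\<forall>n \<ge> 1. evid M w ((Bang ^^ n) c) \<subseteq> truth_set M (bang_fm n c A))))"

definition PE_adapted :: "'w model \<Rightarrow> bool"
  where "PE_adapted M \<longleftrightarrow>
    (\<forall>w \<in> normal M.
      evid M w One = normal M \<and>
      evid M w Zero = {} \<and>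
      (\<forall>s t. evid M w (Cup s t) = evid M w s \<union> evid M w t))"

end

(* One normal world suffices, with L and CS empty: evidence sets are then truth values,
   1 is the full set, every other atom and every !t is empty, and + and \<union> act as
   intersection and union. The condition on CStar is met vacuously. *)
theory Submission
  imports Defs
begin

primrec evidence :: "tm \<Rightarrow> nat set"
  where
    "evidence Zero = {}"
  | "evidence One = {0}"
  | "evidence (Const i) = {}"
  | "evidence (Var i) = {}"
  | "evidence CStar = {}"
  | "evidence (Sum s t) = evidence s \<inter> evidence t"
  | "evidence (Cup s t) = evidence s \<union> evidence t"
  | "evidence (Bang t) = {}"

primrec holds :: "fm \<Rightarrow> bool"
  where
    "holds (Prop i) \<longleftrightarrow> False"
  | "holds \<bottom>\<^sub>F \<longleftrightarrow> False"
  | "holds (F \<rightarrow>\<^sub>F G) \<longleftrightarrow> \<not> holds F \<or> holds G"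
  | "holds (t :\<^sub>F F) \<longleftrightarrow> evidence t = {} \<or> holds F"

definition one_world_model :: "nat model"
  where "one_world_model =
    \<lparr>worlds = {0}, normal = {0}, val = (\<lambda>_. holds), evid = (\<lambda>_. evidence)\<rparr>"

lemma evidence_subset: "evidence t \<subseteq> {0}"
  by (induction t) auto

lemma subset_model_one_world: "subset_model {} {} one_world_model"
proof -
  \<comment> \<open>By \<open>evidence_subset\<close> an evidence set is either empty or
    \<open>{0}\<close>, so the emptiness test in \<open>holds\<close> agrees with inclusion in the
    truth set.\<close>
  have "holds (t :\<^sub>F F) \<longleftrightarrow> evidence t \<subseteq> {v \<in> {0}. holds F}" for t F
    using evidence_subset[of t] by auto
  then show ?thesis
    using evidence_subset
    by (simp add: subset_model_def one_world_model_def truth_set_def)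
qed

lemma PE_adapted_one_world: "PE_adapted one_world_model"
  by (simp add: PE_adapted_def one_world_model_def)

theorem mainTheorem13:
  "\<exists>(L :: logic) (CS :: (tm \<times> fm) set) (M :: nat model).
     constant_specification L CS \<and> subset_model L CS M \<and> PE_adapted M"
proof (intro exI conjI)
  \<comment> \<open>This goal fixes both witnesses as \<open>{}\<close>. Neither \<open>jd\<close>
    nor \<open>jt\<close> could be in \<open>L\<close>, since \<open>Zero\<close> must have empty
    evidence.\<close>
  show "constant_specification {} {}"
    by (simp add: constant_specification_def)
\<comment> \<open>The model is still schematic here; unification with the first rule supplies
  it.\<close>
qed (rule subset_model_one_world PE_adapted_one_world)+

end
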